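(* Let $n\ge 2$, let $x_1,\dots,x_n>0$, and consider the sweep cycle in which each of the two searches of location $i$ has duration $x_i$. Put $$ y_{i1}=\sum_{j=1}^{i-1}(2x_j+d_{j,j+1}+d_{j+1,j}),\qquad y_{i2}=\sum_{j=i+1}^{n}(2x_j+d_{j-1,j}+d_{j,j-1}), $$ $$ c=\sum_{j=1}^n2x_j+\sum_{j=1}^{n-1}(d_{j,j+1}+d_{j+1,j}). $$ Then for each $i\in\{1,\dots,n\}$ the expected time to detect an attacker at location $i$ is $$ g_i(\mathbf x)=\frac1{\lambda_i}+\frac1c\left(\frac{y_{i1}+y_{i2}}{\lambda_i}+\frac{y_{i1}^2+y_{i2}^2+2y_{i1}y_{i2}e^{-\lambda_ix_i}}{1-e^{-2\lambda_ix_i}}-\frac{y_{i1}^2+y_{i2}^2}{2}\right). $$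
   Context: Locations are $1,\dots,n$ with travel times $d_{ij}>0$ ($i\neq j$) and detection rates $\lambda_i>0$. In the sweep cycle considered, the patroller visits $1,2,\dots,n$ in this order, searching location $i$ for time $x_i$ and taking travel time $d_{i,i+1}$ from $i$ to $i+1$, then returns through $n,n-1,\dots,1$, again searching location $i$ for time $x_i$ and taking travel time $d_{i+1,i}$ from $i+1$ to $i$ (the two searches at location $n$ are consecutive, as are the last search at location $1$ and the first search at location $1$ in the next cycle), and repeats this forever with period $c$. While the patroller is searching location $i$, an attacker present there is detected at instantaneous rate $\lambda_i$; otherwise it is not detected. Thus an attacker arriving at location $i$ at time $t$ is undetected at time $t+u$ with probability $e^{-\lambda_iS_i(t,t+u)}$, where $S_i(t,t+u)$ is the time spent searching location $i$ during $[t,t+u]$. The expected time to detect an attacker at location $i$ refers to an arrival time uniform on one period: $g_i(\mathbf x)=\frac1c\int_0^c\int_0^\infty e^{-\lambda_iS_i(t,t+u)}\,du\,dt$. *)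

theory Defs
  imports "HOL-Analysis.Analysis" "HOL-Library.Real_Mod"
begin

datatype activity = Search nat | Travel nat nat

type_synonym itinerary = "(activity \<times> real) list"

definition duration :: "itinerary \<Rightarrow> real" where
  "duration ls = sum_list (map snd ls)"

text \<open>Each leg occupies a half-open time interval; the first leg starts at time 0.\<close>

fun activity_at :: "itinerary \<Rightarrow> real \<Rightarrow> activity option" where
  "activity_at [] t = None"
| "activity_at ((a, l) # ls) t = (if t < l then Some a else activity_at ls (t - l))"

definition sweep_cycle :: "nat \<Rightarrow> (nat \<Rightarrow> nat \<Rightarrow> real) \<Rightarrow> (nat \<Rightarrow> real) \<Rightarrow> itinerary" where
  "sweep_cycle n d x =
     concat (map (\<lambda>i. [(Search i, x i), (Travel i (i + 1), d i (i + 1))]) [1..<n])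
     @ [(Search n, x n), (Search n, x n)]
     @ concat (map (\<lambda>i. [(Travel (i + 1) i, d (i + 1) i), (Search i, x i)]) (rev [1..<n]))"

text \<open>The patroller's activity at time \<open>s\<close> when the itinerary is repeated forever.\<close>

definition patrol_at :: "itinerary \<Rightarrow> real \<Rightarrow> activity option" where
  "patrol_at ls s = activity_at ls (s rmod duration ls)"

text \<open>\<open>search_time ls i t t'\<close> is the amount of time in \<open>[t, t']\<close> spent searching location \<open>i\<close>.\<close>

definition search_time :: "itinerary \<Rightarrow> nat \<Rightarrow> real \<Rightarrow> real \<Rightarrow> real" where
  "search_time ls i t t' = measure lborel {s \<in> {t..t'}. patrol_at ls s = Some (Search i)}"

definition expected_detection_time :: "itinerary \<Rightarrow> (nat \<Rightarrow> real) \<Rightarrow> nat \<Rightarrow> real" where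
  "expected_detection_time ls rate i =
     1 / duration ls *
     (LINT t:{0..duration ls}|lborel. LINT u:{0..}|lborel.
        exp (- rate i * search_time ls i t (t + u)))"

end

theory Submission
  imports Defs
begin

text \<open>
Let \<open>F t\<close> be the mean time until detection of an attacker who arrives at location \<open>i\<close> at time \<open>t\<close>,
and write \<open>r\<close> for the detection rate at \<open>i\<close> and \<open>w\<close> for the duration of one search. While the
patroller searches \<open>i\<close> the function satisfies \<open>F' = r F - 1\<close>, and otherwise \<open>F' = -1\<close>. In integrated
form both follow from one renewal identity, \<open>mean_delay_split\<close>, which rests on the additivity of
search time and on the integrability of the survival probability; the latter decays exponentially
because every period contains a positive amount of searching.

The sweep cycle searches \<open>i\<close> exactly twice per period, for time \<open>w\<close> each, with a gap of length
\<open>y\<^sub>2\<close> between the two searches and a gap of length \<open>y\<^sub>1\<close> around the end of the period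
(\<open>sweep_cycle_decomposition\<close> and \<open>activity_at_two_occurrences\<close>). Let \<open>A\<close> and \<open>B\<close> be the values of \<open>F\<close>
at the start of the searches that precede the gaps \<open>y\<^sub>2\<close> and \<open>y\<^sub>1\<close>. The two differential
equations and periodicity give, with \<open>e = exp (- r w)\<close>,
\<open>A = (1 - e) / r + e (y\<^sub>2 + B)\<close> and \<open>B = (1 - e) / r + e (y\<^sub>1 + A)\<close>,
which determine \<open>A\<close> and \<open>B\<close>. Over a search the integral of \<open>F\<close> is \<open>1 / r\<close> times the increment of \<open>F\<close>
plus the length; over a gap that ends where \<open>F = A\<close> it is \<open>y\<^sub>1\<^sup>2 / 2 + y\<^sub>1 A\<close>, and
similarly for the other gap. The increments of \<open>F\<close> over the searches add up to \<open>y\<^sub>1 + y\<^sub>2\<close>, since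
\<open>F\<close> is periodic and falls by the length of each gap. Hence the integral of \<open>F\<close> over a period \<open>c\<close> is
\<open>c / r + (y\<^sub>1\<^sup>2 + y\<^sub>2\<^sup>2) / 2 + y\<^sub>1 A + y\<^sub>2 B\<close>, and inserting \<open>A\<close> and \<open>B\<close>
gives the formula (\<open>integral_mean_delay_two_searches\<close>).
\<close>

section \<open>Integration over adjacent intervals\<close>

text \<open>
Two closed intervals with a common end point overlap in a null set, so integrals over adjacent
closed blocks of time can be added up without passing to half-open intervals.
\<close>

lemma set_integral_Un_touching:
  fixes f :: "real \<Rightarrow> real"
  assumes "A \<inter> B \<subseteq> {b}" "A \<in> sets borel" "B \<in> sets borel"
    and "set_integrable lborel A f" "set_integrable lborel B f"
  shows "(LINT s:A \<union> B|lborel. f s) = (LINT s:A|lborel. f s) + (LINT s:B|lborel. f s)"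
proof (rule set_integral_Un_AE)
  show "AE s in lborel. \<not> (s \<in> A \<and> s \<in> B)"
    using AE_lborel_singleton[of b] assms(1) by (auto elim!: eventually_mono)
qed (use assms in auto)

lemma set_integral_Icc_FTC:
  fixes f G :: "real \<Rightarrow> real"
  assumes "a \<le> b" and G: "\<And>s. (G has_real_derivative g s) (at s)"
    and g: "continuous_on UNIV g" and eq: "\<And>s. s \<in> {a..b} \<Longrightarrow> f s = g s"
  shows "set_integrable lborel {a..b} f" and "(LINT s:{a..b}|lborel. f s) = G b - G a"
proof -
  have "has_bochner_integral lborel (\<lambda>s. g s * indicator {a..b} s) (G b - G a)"
    by (rule has_bochner_integral_FTC_Icc_real[OF \<open>a \<le> b\<close>])
       (use G g in \<open>auto simp: continuous_on_eq_continuous_at\<close>)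
  also have "(\<lambda>s. g s * indicator {a..b} s) = (\<lambda>s. indicator {a..b} s *\<^sub>R f s)"
    using eq by (auto simp: indicator_def fun_eq_iff)
  finally have "has_bochner_integral lborel (\<lambda>s. indicator {a..b} s *\<^sub>R f s) (G b - G a)" .
  then show "set_integrable lborel {a..b} f" "(LINT s:{a..b}|lborel. f s) = G b - G a"
    unfolding set_integrable_def set_lebesgue_integral_def
    by (auto simp: has_bochner_integral_iff)
qed

lemma set_integrable_exp_decay:
  assumes "a > (0::real)"
  shows "set_integrable lborel {0..} (\<lambda>u. exp (- a * u))"
proof -
  have "(\<lambda>u. exp (- a * u)) absolutely_integrable_on {0..}"
    by (rule nonnegative_absolutely_integrable_1)
       (use integrable_on_exp_minus_to_infinity[OF assms, of 0] in auto)
  then show ?thesis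
    unfolding set_integrable_def by (subst (asm) integrable_completion) auto
qed

section \<open>Detection delay under a periodic search pattern\<close>

locale periodic_search =
  fixes E :: "real set" and c :: real
  assumes E_borel [measurable]: "E \<in> sets borel"
    and period_pos: "c > 0"
    and periodic: "s + c \<in> E \<longleftrightarrow> s \<in> E"
begin

definition searched :: "real \<Rightarrow> real \<Rightarrow> real" where
  "searched t t' = measure lborel ({t..t'} \<inter> E)"

definition mean_delay :: "real \<Rightarrow> real \<Rightarrow> real" where
  "mean_delay r t = (LINT u:{0..}|lborel. exp (- r * searched t (t + u)))"

lemma searched_finite: "{t..t'} \<inter> E \<in> fmeasurable lborel"
  by (rule fmeasurable_Int_fmeasurable) (use fmeasurable_cbox[of t t'] in auto)

lemma searched_eq_integral:
  "set_integrable lborel {t..t'} (indicator E :: real \<Rightarrow> real)"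
  "searched t t' = (LINT s:{t..t'}|lborel. indicator E s)"
proof -
  have "integrable lborel (indicator ({t..t'} \<inter> E) :: real \<Rightarrow> real)"
    using searched_finite[of t t'] by (auto simp: fmeasurable_def)
  then show "set_integrable lborel {t..t'} (indicator E :: real \<Rightarrow> real)"
    by (simp add: set_integrable_def flip: indicator_inter_arith)
  show "searched t t' = (LINT s:{t..t'}|lborel. indicator E s)"
    by (simp add: searched_def set_lebesgue_integral_def flip: indicator_inter_arith)
qed

lemma searched_nonneg: "searched t t' \<ge> 0"
  by (simp add: searched_def)

lemma searched_add:
  assumes "t \<le> t'" "t' \<le> t''"
  shows "searched t t'' = searched t t' + searched t' t''"
proof -
  have "(LINT s:{t..t'} \<union> {t'..t''}|lborel. indicator E s) =
      (LINT s:{t..t'}|lborel. indicator E s) + (LINT s:{t'..t''}|lborel. indicator E s :: real)"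
    by (rule set_integral_Un_touching[of _ _ t']) (auto simp: searched_eq_integral)
  moreover have "{t..t'} \<union> {t'..t''} = {t..t''}"
    using assms by auto
  ultimately show ?thesis
    by (simp add: searched_eq_integral(2))
qed

lemma searched_mono: "t \<le> t' \<Longrightarrow> t' \<le> t'' \<Longrightarrow> searched t t' \<le> searched t t''"
  using searched_add[of t t' t''] searched_nonneg[of t' t''] by simp

lemma searched_shift: "searched (t + c) (t' + c) = searched t t'"
proof -
  have "searched (t + c) (t' + c) = (\<integral>s. indicator {t + c..t' + c} s * indicator E s \<partial>lborel)"
    by (simp add: searched_eq_integral set_lebesgue_integral_def)
  also have "\<dots> = (\<integral>s. indicator {t + c..t' + c} (c + 1 * s) * indicator E (c + 1 * s) \<partial>lborel)"
    by (subst lborel_integral_real_affine[of 1 _ c]) auto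
  also have "\<dots> = (\<integral>s. indicator {t..t'} s * indicator E s \<partial>lborel)"
    using periodic by (intro Bochner_Integration.integral_cong) (auto simp: indicator_def add.commute)
  also have "\<dots> = searched t t'"
    by (simp add: searched_eq_integral set_lebesgue_integral_def)
  finally show ?thesis .
qed

lemma searched_inside:
  assumes "t \<le> t'" "{t..<t'} \<subseteq> E"
  shows "searched t t' = t' - t"
proof -
  have "searched t t' = (LINT s:{t..t'}|lborel. 1)"
    unfolding searched_eq_integral(2) set_lebesgue_integral_def
  proof (rule integral_cong_AE)
    show "AE s in lborel. indicator {t..t'} s *\<^sub>R indicator E s = indicator {t..t'} s *\<^sub>R (1::real)"
      using AE_lborel_singleton[of t']
    proof eventually_elim
      case (elim s)
      then have "s \<in> {t..t'} \<Longrightarrow> s \<in> E"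
        using assms by auto
      then show ?case
        by (auto simp: indicator_def)
    qed
  qed auto
  then show ?thesis
    using assms by (simp add: set_lebesgue_integral_def)
qed

lemma searched_outside:
  assumes "{t..<t'} \<inter> E = {}"
  shows "searched t t' = 0"
proof -
  have "searched t t' = (LINT s:{t..t'}|lborel. 0)"
    unfolding searched_eq_integral(2) set_lebesgue_integral_def
  proof (rule integral_cong_AE)
    show "AE s in lborel. indicator {t..t'} s *\<^sub>R indicator E s = indicator {t..t'} s *\<^sub>R (0::real)"
      using AE_lborel_singleton[of t']
    proof eventually_elim
      case (elim s)
      then have "s \<in> {t..t'} \<Longrightarrow> s \<in> - E"
        using assms by (auto simp: disjoint_iff)
      then show ?case
        by (auto simp: indicator_def)
    qed
  qed auto
  then show ?thesis
    by (simp add: set_lebesgue_integral_def)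
qed

text \<open>
Only whole periods are counted here, which gives up less than one period. The resulting linear
growth is what makes the survival probability decay exponentially.
\<close>

lemma searched_lower_bound:
  assumes "u \<ge> 0"
  shows "searched 0 u \<ge> (u / c - 1) * searched 0 c"
proof -
  have shift: "searched (real k * c) (real k * c + c) = searched 0 c" for k
  proof (induction k)
    case (Suc k)
    then show ?case
      using searched_shift[of "real k * c" "real k * c + c"] by (simp add: algebra_simps)
  qed simp
  have cycles: "searched 0 (real k * c) = real k * searched 0 c" for k
  proof (induction k)
    case 0
    show ?case by (simp add: searched_outside)
  next
    case (Suc k)
    have "searched 0 (real k * c + c) = real k * searched 0 c + searched 0 c"
      using searched_add[of 0 "real k * c" "real k * c + c"] period_pos Suc shift[of k] by simp
    then show ?case by (simp add: algebra_simps)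
  qed
  define k where "k = nat \<lfloor>u / c\<rfloor>"
  have "u / c \<ge> 0"
    using assms period_pos by simp
  then have k: "real k \<le> u / c" "u / c - 1 \<le> real k"
    unfolding k_def by linarith+
  have "(u / c - 1) * searched 0 c \<le> real k * searched 0 c"
    using k searched_nonneg by (intro mult_right_mono) auto
  also have "\<dots> = searched 0 (real k * c)"
    by (simp add: cycles)
  also have "\<dots> \<le> searched 0 u"
    using k period_pos by (intro searched_mono) (auto simp: field_simps)
  finally show ?thesis .
qed

text \<open>
The Bochner integral of a non-integrable function is 0 by convention, so without integrability
the renewal identity \<open>mean_delay_split\<close> would be meaningless. Measurability comes from
monotonicity of the search time in the length of the window.
\<close>

lemma survival_integrable:
  assumes "r > 0" "searched 0 c > 0" "t \<ge> 0"
  shows "set_integrable lborel {0..} (\<lambda>u. exp (- r * searched t (t + u)))"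
proof -
  let ?m = "searched 0 c"
  have "mono (\<lambda>u. searched t (t + max 0 u))"
    by (intro monoI searched_mono) auto
  then have [measurable]: "(\<lambda>u. searched t (t + max 0 u)) \<in> borel_measurable borel"
    by (rule borel_measurable_mono)
  have int: "set_integrable lborel {0..}
      (\<lambda>u. exp (r * (searched 0 t + ?m)) * exp (- (r * ?m / c) * u))"
    using assms period_pos by (intro set_integrable_mult_right set_integrable_exp_decay) auto
  have bound: "exp (- r * searched t (t + u)) \<le>
      exp (r * (searched 0 t + ?m)) * exp (- (r * ?m / c) * u)" if "u \<ge> 0" for u
  proof -
    have "(u / c - 1) * ?m - searched 0 t \<le> searched 0 u - searched 0 t"
      using searched_lower_bound[OF that] by simp
    also have "\<dots> \<le> searched 0 (t + u) - searched 0 t"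
      using searched_mono[of 0 u "t + u"] assms that by simp
    also have "\<dots> = searched t (t + u)"
      using searched_add[of 0 t "t + u"] assms that by simp
    finally have "r * ((u / c - 1) * ?m - searched 0 t) \<le> r * searched t (t + u)"
      using assms by simp
    then have "- r * searched t (t + u) \<le> r * (searched 0 t + ?m) + - (r * ?m / c) * u"
      by (simp add: algebra_simps)
    then show ?thesis
      by (simp only: exp_add[symmetric] exp_le_cancel_iff)
  qed
  have "set_borel_measurable lborel {0..} (\<lambda>u. exp (- r * searched t (t + max 0 u)))"
    unfolding set_borel_measurable_def by measurable
  also have "?this \<longleftrightarrow> set_borel_measurable lborel {0..} (\<lambda>u. exp (- r * searched t (t + u)))"
    unfolding set_borel_measurable_def
    by (rule arg_cong[of _ _ "\<lambda>f. f \<in> borel_measurable lborel"]) (auto simp: indicator_def fun_eq_iff)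
  finally show ?thesis
    by (rule set_integrable_bound[OF int]) (use bound in \<open>auto intro!: AE_I2\<close>)
qed

text \<open>
The renewal identity: an attacker who arrives at \<open>t\<close> and survives for a further time \<open>w\<close> is, by
additivity of search time, in the situation of one who arrives at \<open>t + w\<close>.
\<close>

lemma mean_delay_split:
  assumes "r > 0" "searched 0 c > 0" "t \<ge> 0" "w \<ge> 0"
  shows "mean_delay r t = (LINT u:{0..w}|lborel. exp (- r * searched t (t + u)))
           + exp (- r * searched t (t + w)) * mean_delay r (t + w)"
proof -
  let ?f = "\<lambda>u. exp (- r * searched t (t + u))"
  note int = survival_integrable[OF assms(1-3)]
  have "mean_delay r t = (LINT u:{0..w} \<union> {w..}|lborel. ?f u)"
    unfolding mean_delay_def using assms by (intro arg_cong[of _ _ "\<lambda>A. set_lebesgue_integral lborel A ?f"]) auto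
  also have "\<dots> = (LINT u:{0..w}|lborel. ?f u) + (LINT u:{w..}|lborel. ?f u)"
    using assms by (intro set_integral_Un_touching[of _ _ w] set_integrable_subset[OF int]) auto
  also have "(LINT u:{w..}|lborel. ?f u) = (\<integral>u. indicator {w..} (w + 1 * u) * ?f (w + 1 * u) \<partial>lborel)"
    unfolding set_lebesgue_integral_def
    by (subst lborel_integral_real_affine[of 1 _ w]) auto
  also have "\<dots> = (LINT u:{0..}|lborel.
      exp (- r * searched t (t + w)) * exp (- r * searched (t + w) (t + w + u)))"
    unfolding set_lebesgue_integral_def
  proof (rule Bochner_Integration.integral_cong[OF refl])
    fix u :: real
    have "?f (w + u) = exp (- r * searched t (t + w)) * exp (- r * searched (t + w) (t + w + u))" if "u \<ge> 0"
    proof -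
      have "searched t (t + (w + u)) = searched t (t + w) + searched (t + w) (t + w + u)"
        using searched_add[of t "t + w" "t + w + u"] assms that by (simp add: add.assoc)
      then show ?thesis
        by (simp only: distrib_left exp_add)
    qed
    then show "indicator {w..} (w + 1 * u) * ?f (w + 1 * u) = indicator {0..} u *\<^sub>R
        (exp (- r * searched t (t + w)) * exp (- r * searched (t + w) (t + w + u)))"
      by (simp add: indicator_def)
  qed
  also have "\<dots> = exp (- r * searched t (t + w)) * mean_delay r (t + w)"
    by (simp add: mean_delay_def)
  finally show ?thesis .
qed

lemma mean_delay_periodic: "mean_delay r (t + c) = mean_delay r t"
proof -
  have "searched (t + c) (t + c + u) = searched t (t + u)" for u
  proof -
    have eq: "t + c + u = t + u + c"
      by simp
    show ?thesis
      unfolding eq by (rule searched_shift)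
  qed
  then show ?thesis
    by (simp only: mean_delay_def)
qed

lemma mean_delay_gap:
  assumes "r > 0" "searched 0 c > 0" "0 \<le> t" "t \<le> q" "{t..<q} \<inter> E = {}"
  shows "mean_delay r t = (q - t) + mean_delay r q"
proof -
  have "searched t (t + u) = 0" if "u \<in> {0..q - t}" for u
  proof (rule searched_outside)
    have "{t..<t + u} \<subseteq> {t..<q}"
      using that by auto
    then show "{t..<t + u} \<inter> E = {}"
      using assms(5) by blast
  qed
  then have "(LINT u:{0..q - t}|lborel. exp (- r * searched t (t + u))) = (LINT u:{0..q - t}|lborel. 1)"
    by (intro set_lebesgue_integral_cong) auto
  then show ?thesis
    using mean_delay_split[OF assms(1-3), of "q - t"] assms searched_outside[OF assms(5)]
    by (simp add: set_lebesgue_integral_def)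
qed

lemma mean_delay_search:
  assumes "r > 0" "searched 0 c > 0" "0 \<le> t" "t \<le> q" "{t..<q} \<subseteq> E"
  shows "mean_delay r t = 1 / r + (mean_delay r q - 1 / r) * exp (- r * (q - t))"
proof -
  have eq: "searched t (t + u) = u" if "u \<in> {0..q - t}" for u
    using that assms(5) searched_inside[of t "t + u"] by (auto simp: subset_eq)
  have "(LINT u:{0..q - t}|lborel. exp (- r * searched t (t + u)))
      = - exp (- r * (q - t)) / r - (- exp (- r * 0) / r)"
    by (rule set_integral_Icc_FTC(2)[where g = "\<lambda>u. exp (- r * u)"])
       (use assms eq in \<open>auto intro!: derivative_eq_intros continuous_intros\<close>)
  moreover have "searched t (t + (q - t)) = q - t"
    using eq[of "q - t"] assms by simp
  ultimately show ?thesis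
    using mean_delay_split[OF assms(1-3), of "q - t"] assms(4) by (simp add: left_diff_distrib)
qed

lemma integral_mean_delay_gap:
  assumes "r > 0" "searched 0 c > 0" "0 \<le> p" "p \<le> q" "{p..<q} \<inter> E = {}"
  shows "set_integrable lborel {p..q} (mean_delay r)"
    and "(LINT t:{p..q}|lborel. mean_delay r t) = (q - p)\<^sup>2 / 2 + (q - p) * mean_delay r q"
proof -
  have eq: "mean_delay r t = (q - t) + mean_delay r q" if "t \<in> {p..q}" for t
  proof (rule mean_delay_gap)
    have "{t..<q} \<subseteq> {p..<q}"
      using that by auto
    then show "{t..<q} \<inter> E = {}"
      using assms(5) by blast
  qed (use that assms in auto)
  let ?G = "\<lambda>t. - (q - t)\<^sup>2 / 2 + t * mean_delay r q"
  have G: "(?G has_real_derivative (q - t) + mean_delay r q) (at t)" for t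
    by (auto intro!: derivative_eq_intros simp: field_simps)
  have cont: "continuous_on UNIV (\<lambda>t. (q - t) + mean_delay r q)"
    by (intro continuous_intros)
  note FTC = set_integral_Icc_FTC[OF \<open>p \<le> q\<close> G cont eq]
  show "set_integrable lborel {p..q} (mean_delay r)"
    by (rule FTC(1))
  show "(LINT t:{p..q}|lborel. mean_delay r t) = (q - p)\<^sup>2 / 2 + (q - p) * mean_delay r q"
    by (subst FTC(2)) (auto simp: algebra_simps)
qed

text \<open>
On a block of searching the mean delay solves \<open>F' = r F - 1\<close>, so its integral depends only on its
values at the two ends of the block; no exponential appears in the formula.
\<close>

lemma integral_mean_delay_search:
  assumes "r > 0" "searched 0 c > 0" "0 \<le> p" "p \<le> q" "{p..<q} \<subseteq> E"
  shows "set_integrable lborel {p..q} (mean_delay r)"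
    and "(LINT t:{p..q}|lborel. mean_delay r t) = (mean_delay r q - mean_delay r p + (q - p)) / r"
proof -
  let ?K = "mean_delay r q - 1 / r"
  have eq: "mean_delay r t = 1 / r + ?K * exp (- r * (q - t))" if "t \<in> {p..q}" for t
    using that assms by (intro mean_delay_search) auto
  let ?G = "\<lambda>t. t / r + ?K * exp (- r * (q - t)) / r"
  have G: "(?G has_real_derivative 1 / r + ?K * exp (- r * (q - t))) (at t)" for t
    using assms by (auto intro!: derivative_eq_intros)
  have cont: "continuous_on UNIV (\<lambda>t. 1 / r + ?K * exp (- r * (q - t)))"
    by (intro continuous_intros)
  note FTC = set_integral_Icc_FTC[OF \<open>p \<le> q\<close> G cont eq]
  show "set_integrable lborel {p..q} (mean_delay r)"
    by (rule FTC(1))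
  show "(LINT t:{p..q}|lborel. mean_delay r t) = (mean_delay r q - mean_delay r p + (q - p)) / r"
    using assms eq[of p] by (subst FTC(2)) (simp_all add: add_divide_distrib diff_divide_distrib)
qed

text \<open>
The period, cut at the starts and ends of the two searches, consists of a gap \<open>a\<close>, a search, a gap
\<open>y\<close>, a search and a gap \<open>b\<close>. Since the mean delay is periodic, the gaps \<open>b\<close> and \<open>a\<close> act as one gap
of length \<open>a + b\<close> that wraps around the end of the period. The delays at the starts of the two
searches satisfy two linear equations, one for each search and the gap behind it; solving them
yields the denominator \<open>1 - exp (- 2 * r * w)\<close>.
\<close>

lemma integral_mean_delay_two_searches:
  assumes "r > 0" "a \<ge> 0" "w > 0" "y \<ge> 0" "b \<ge> 0" and c: "c = a + w + y + w + b"
    and E: "\<And>s. 0 \<le> s \<Longrightarrow> s < c \<Longrightarrow> s \<in> E \<longleftrightarrow> s \<in> {a..<a + w} \<union> {a + w + y..<a + w + y + w}"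
  shows "(LINT t:{0..c}|lborel. mean_delay r t) =
    c / r + (a + b + y) / r
    + ((a + b)\<^sup>2 + y\<^sup>2 + 2 * (a + b) * y * exp (- r * w)) / (1 - exp (- 2 * r * w))
    - ((a + b)\<^sup>2 + y\<^sup>2) / 2"
proof -
  let ?F = "mean_delay r" and ?e = "exp (- r * w)"
  define p1 p2 p3 p4 where p_defs: "p1 = a" "p2 = a + w" "p3 = a + w + y" "p4 = a + w + y + w"
  have p: "0 \<le> p1" "p1 \<le> p2" "p2 \<le> p3" "p3 \<le> p4" "p4 \<le> c"
    using assms by (auto simp: p_defs)
  have blocks: "{0..<p1} \<inter> E = {}" "{p1..<p2} \<subseteq> E" "{p2..<p3} \<inter> E = {}" "{p3..<p4} \<subseteq> E" "{p4..<c} \<inter> E = {}"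
    using E p assms by (auto simp: p_defs disjoint_iff)
  have "searched 0 c = searched 0 p1 + (w + searched p2 c)"
    using searched_add[of 0 p1 c] searched_add[of p1 p2 c] searched_inside[OF _ blocks(2)] p
    by (simp add: p_defs)
  then have m: "searched 0 c > 0"
    using searched_nonneg[of 0 p1] searched_nonneg[of p2 c] \<open>w > 0\<close> by simp
  note gap = integral_mean_delay_gap[OF \<open>r > 0\<close> m] and search = integral_mean_delay_search[OF \<open>r > 0\<close> m]
  have join: "set_integrable lborel {0..v} ?F \<and> (LINT t:{0..v}|lborel. ?F t) = I + J"
    if "set_integrable lborel {0..u} ?F \<and> (LINT t:{0..u}|lborel. ?F t) = I"
      and "set_integrable lborel {u..v} ?F" "(LINT t:{u..v}|lborel. ?F t) = J" "0 \<le> u" "u \<le> v"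
    for u v I J
  proof -
    have "{0..v} = {0..u} \<union> {u..v}"
      using that by auto
    moreover have "(LINT t:{0..u} \<union> {u..v}|lborel. ?F t) = I + J"
      by (subst set_integral_Un_touching[of _ _ u]) (use that in auto)
    ultimately show ?thesis
      using that by (auto intro!: set_integrable_Un)
  qed
  have F0: "?F 0 = a + ?F p1"
    using mean_delay_gap[OF \<open>r > 0\<close> m _ _ blocks(1)] p by (simp add: p_defs)
  have F1: "?F p1 = 1 / r + (?F p2 - 1 / r) * ?e"
    using mean_delay_search[OF \<open>r > 0\<close> m _ _ blocks(2)] p by (simp add: p_defs)
  have F2: "?F p2 = y + ?F p3"
    using mean_delay_gap[OF \<open>r > 0\<close> m _ _ blocks(3)] p by (simp add: p_defs)
  have F3: "?F p3 = 1 / r + (?F p4 - 1 / r) * ?e"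
    using mean_delay_search[OF \<open>r > 0\<close> m _ _ blocks(4)] p by (simp add: p_defs)
  have Fc: "?F c = ?F 0"
    using mean_delay_periodic[of r 0] by simp
  have F4: "?F p4 = b + ?F 0"
    using mean_delay_gap[OF \<open>r > 0\<close> m _ _ blocks(5)] p Fc by (simp add: p_defs c)
  have "set_integrable lborel {0..p1} ?F \<and> (LINT t:{0..p1}|lborel. ?F t) = a\<^sup>2 / 2 + a * ?F p1"
    using gap[OF _ _ blocks(1)] p by (simp add: p_defs)
  then have "set_integrable lborel {0..p2} ?F \<and> (LINT t:{0..p2}|lborel. ?F t) =
      a\<^sup>2 / 2 + a * ?F p1 + (?F p2 - ?F p1 + w) / r"
    by (rule join) (use search[OF _ _ blocks(2)] p in \<open>auto simp: p_defs\<close>)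
  then have "set_integrable lborel {0..p3} ?F \<and> (LINT t:{0..p3}|lborel. ?F t) =
      a\<^sup>2 / 2 + a * ?F p1 + (?F p2 - ?F p1 + w) / r + (y\<^sup>2 / 2 + y * ?F p3)"
    by (rule join) (use gap[OF _ _ blocks(3)] p in \<open>auto simp: p_defs\<close>)
  then have "set_integrable lborel {0..p4} ?F \<and> (LINT t:{0..p4}|lborel. ?F t) =
      a\<^sup>2 / 2 + a * ?F p1 + (?F p2 - ?F p1 + w) / r + (y\<^sup>2 / 2 + y * ?F p3) + (?F p4 - ?F p3 + w) / r"
    by (rule join) (use search[OF _ _ blocks(4)] p in \<open>auto simp: p_defs\<close>)
  then have "set_integrable lborel {0..c} ?F \<and> (LINT t:{0..c}|lborel. ?F t) =
      a\<^sup>2 / 2 + a * ?F p1 + (?F p2 - ?F p1 + w) / r + (y\<^sup>2 / 2 + y * ?F p3) + (?F p4 - ?F p3 + w) / r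
      + (b\<^sup>2 / 2 + b * ?F c)"
    by (rule join) (use gap[OF _ _ blocks(5)] p in \<open>auto simp: p_defs c\<close>)
  then have integral: "(LINT t:{0..c}|lborel. ?F t) =
      a\<^sup>2 / 2 + a * ?F p1 + (y + ?F p3 - ?F p1 + w) / r + (y\<^sup>2 / 2 + y * ?F p3)
      + (b + a + ?F p1 - ?F p3 + w) / r + (b\<^sup>2 / 2 + b * (a + ?F p1))"
    using Fc F0 F2 F4 by simp
  also have "\<dots> = c / r + ((a + b)\<^sup>2 + y\<^sup>2) / 2 + (a + b) * ?F p1 + y * ?F p3"
    by (simp add: c power2_eq_square add_divide_distrib diff_divide_distrib distrib_left distrib_right)
  finally have total: "(LINT t:{0..c}|lborel. ?F t) =
      c / r + ((a + b)\<^sup>2 + y\<^sup>2) / 2 + (a + b) * ?F p1 + y * ?F p3" .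
  have e: "?e < 1" "1 - ?e\<^sup>2 \<noteq> 0" "exp (- 2 * r * w) = ?e\<^sup>2"
  proof -
    show less: "?e < 1"
      using assms by simp
    then show "1 - ?e\<^sup>2 \<noteq> 0"
      using power_strict_mono[of ?e 1 2] by simp
    show "exp (- 2 * r * w) = ?e\<^sup>2"
      by (simp add: power2_eq_square flip: exp_add)
  qed
  \<comment> \<open>The delay at the start of a search is \<open>1 / r\<close> if the search never ends; only the excess over
    that value is propagated by the two equations.\<close>
  define A B where "A = ?F p1 - 1 / r" "B = ?F p3 - 1 / r"
  have "A = (y + B) * ?e" "B = ((a + b) + A) * ?e"
    using F0 F1 F2 F3 F4 by (auto simp: A_B_def)
  then have "A * (1 - ?e\<^sup>2) = y * ?e + (a + b) * ?e\<^sup>2" "B * (1 - ?e\<^sup>2) = (a + b) * ?e + y * ?e\<^sup>2"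
    by (algebra, algebra)
  then have AB: "A = (y * ?e + (a + b) * ?e\<^sup>2) / (1 - ?e\<^sup>2)" "B = ((a + b) * ?e + y * ?e\<^sup>2) / (1 - ?e\<^sup>2)"
    using e by (simp_all add: eq_divide_eq)
  have "(a + b) * A + y * B =
      ((a + b)\<^sup>2 + y\<^sup>2 + 2 * (a + b) * y * ?e) / (1 - ?e\<^sup>2) - ((a + b)\<^sup>2 + y\<^sup>2)"
    unfolding AB using e(2) by (simp add: divide_simps) algebra
  then show ?thesis
    unfolding total e(3) using A_B_def by (simp add: algebra_simps add_divide_distrib)
qed

end

lemma periodic_search_rmod:
  assumes "c > 0" and [measurable]: "A \<in> sets borel"
  shows "periodic_search {s. s rmod c \<in> A} c"
proof
  have meas: "(\<lambda>s. s rmod c) \<in> borel_measurable borel"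
    unfolding rmod_def by measurable
  have "{s. s rmod c \<in> A} = (\<lambda>s. s rmod c) -` A \<inter> space borel"
    by auto
  also have "\<dots> \<in> sets borel"
    by (rule measurable_sets[OF meas assms(2)])
  finally show "{s. s rmod c \<in> A} \<in> sets borel" .
  show "s + c \<in> {s. s rmod c \<in> A} \<longleftrightarrow> s \<in> {s. s rmod c \<in> A}" for s
    using rmod_add[of s c c] by simp
qed (rule assms(1))

section \<open>The sweep cycle\<close>

lemma duration_simps [simp]:
  "duration [] = 0" "duration (l # ls) = snd l + duration ls"
  "duration (ls @ ls') = duration ls + duration ls'"
  by (simp_all add: duration_def)

lemma duration_concat_map: "duration (concat (map f js)) = (\<Sum>j\<leftarrow>js. duration (f j))"
  by (induction js) auto

lemma duration_concat_map_rev: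
  "duration (concat (map f (rev js))) = (\<Sum>j\<leftarrow>js. duration (f j))"
  by (induction js) auto

lemma duration_concat_map_upt:
  "duration (concat (map f [a..<b])) = (\<Sum>j\<in>{a..<b}. duration (f j))"
  "duration (concat (map f (rev [a..<b]))) = (\<Sum>j\<in>{a..<b}. duration (f j))"
  by (simp_all only: duration_concat_map_rev,
      simp_all add: duration_concat_map interv_sum_list_conv_sum_set_nat)

lemma duration_nonneg: "\<forall>l\<in>set ls. snd l \<ge> 0 \<Longrightarrow> duration ls \<ge> 0"
  by (induction ls) auto

text \<open>
With a leg of negative duration, an earlier leg could last beyond \<open>duration ls\<close>, and the case
distinction would pick the wrong list.
\<close>

lemma activity_at_append:
  assumes "\<forall>l\<in>set ls. snd l \<ge> 0" "t \<ge> 0"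
  shows "activity_at (ls @ ls') t =
    (if t < duration ls then activity_at ls t else activity_at ls' (t - duration ls))"
  using assms
proof (induction ls arbitrary: t)
  case (Cons l ls)
  obtain act len where "l = (act, len)"
    by (cases l)
  then show ?case
    using Cons.IH[of "t - len"] Cons.prems duration_nonneg[of ls] by (auto simp: algebra_simps)
qed simp

lemma activity_at_absent: "act \<notin> fst ` set ls \<Longrightarrow> activity_at ls t \<noteq> Some act"
  by (induction ls t rule: activity_at.induct) auto

lemma activity_at_two_occurrences:
  assumes ls: "ls = P @ [(act, w)] @ Q @ [(act, w)] @ R"
    and nonneg: "\<forall>l\<in>set ls. snd l \<ge> 0"
    and absent: "act \<notin> fst ` set (P @ Q @ R)" and "s \<ge> 0"
  defines "a \<equiv> duration P" and "y \<equiv> duration Q"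
  shows "activity_at ls s = Some act \<longleftrightarrow> s \<in> {a..<a + w} \<union> {a + w + y..<a + w + y + w}"
proof -
  have nn: "\<forall>l\<in>set P. snd l \<ge> 0" "\<forall>l\<in>set Q. snd l \<ge> 0" "w \<ge> 0"
    using nonneg ls by auto
  have pos: "a \<ge> 0" "y \<ge> 0"
    using nn duration_nonneg by (auto simp: a_def y_def)
  have abs: "activity_at P t \<noteq> Some act" "activity_at Q t \<noteq> Some act" "activity_at R t \<noteq> Some act" for t
    using absent by (auto intro!: activity_at_absent)
  show ?thesis
  proof (cases "s < a + w")
    case True
    then show ?thesis
      using abs pos nn \<open>s \<ge> 0\<close> unfolding ls
      by (subst activity_at_append) (auto simp: a_def)
  next
    case False
    then have "activity_at ls s = activity_at (Q @ [(act, w)] @ R) (s - a - w)"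
      using nn \<open>s \<ge> 0\<close> unfolding ls by (subst activity_at_append) (auto simp: a_def)
    also have "\<dots> = Some act \<longleftrightarrow> a + w + y \<le> s \<and> s < a + w + y + w"
      using abs pos nn False
      by (subst activity_at_append) (auto simp: y_def)
    finally show ?thesis
      using False pos by auto
  qed
qed

lemma duration_sweep_cycle:
  assumes "n \<ge> 1"
  shows "duration (sweep_cycle n d x) =
    (\<Sum>j\<in>{1..n}. 2 * x j) + (\<Sum>j\<in>{1..<n}. d j (j + 1) + d (j + 1) j)"
proof -
  have "{1..n} = insert n {1..<n}"
    using assms by auto
  then show ?thesis
    by (simp add: sweep_cycle_def duration_concat_map_upt sum.distrib flip: sum_distrib_left)
qed

text \<open>
Between the two searches of \<open>i\<close> the patroller is at the locations beyond \<open>i\<close> or travelling to and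
from them; before the first and after the second search it is on the other side. At the turning
point \<open>i = n\<close> the two searches are adjacent, and \<open>Q\<close> is empty.
\<close>

lemma sweep_cycle_decomposition:
  assumes "i \<in> {1..n}"
  obtains P Q R where
    "sweep_cycle n d x = P @ [(Search i, x i)] @ Q @ [(Search i, x i)] @ R"
    "Search i \<notin> fst ` set (P @ Q @ R)"
    "duration P + duration R = (\<Sum>j\<in>{1..<i}. 2 * x j + d j (j + 1) + d (j + 1) j)"
    "duration Q = (\<Sum>j\<in>{i+1..n}. 2 * x j + d (j - 1) j + d j (j - 1))"
proof -
  let ?out = "\<lambda>j. [(Search j, x j), (Travel j (j + 1), d j (j + 1))]"
  let ?back = "\<lambda>j. [(Travel (j + 1) j, d (j + 1) j), (Search j, x j)]"
  let ?P = "concat (map ?out [1..<i])" and ?R = "concat (map ?back (rev [1..<i]))"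
  have PR: "duration ?P + duration ?R = (\<Sum>j\<in>{1..<i}. 2 * x j + d j (j + 1) + d (j + 1) j)"
    by (simp add: duration_concat_map_upt sum.distrib flip: sum_distrib_left)
  show thesis
  proof (cases "i = n")
    case True
    then show thesis
      using PR by (intro that[of ?P "[]" ?R]) (auto simp: sweep_cycle_def)
  next
    case False
    with assms have "i < n" "i \<ge> 1"
      by auto
    let ?Q = "(Travel i (i + 1), d i (i + 1)) # concat (map ?out [Suc i..<n])
      @ [(Search n, x n), (Search n, x n)]
      @ concat (map ?back (rev [Suc i..<n])) @ [(Travel (i + 1) i, d (i + 1) i)]"
    have split: "[1..<n] = [1..<i] @ i # [Suc i..<n]"
      using \<open>i < n\<close> \<open>i \<ge> 1\<close> upt_add_eq_append[of 1 i "n - i"] by (simp add: upt_conv_Cons)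
    have "{Suc i..n} = insert n {Suc i..<n}" "{i..<n} = insert i {Suc i..<n}"
      using \<open>i < n\<close> by auto
    moreover have "(\<Sum>j\<in>{Suc i..n}. d (j - 1) j + d j (j - 1)) = (\<Sum>j\<in>{i..<n}. d j (j + 1) + d (j + 1) j)"
      by (simp only: atLeastLessThanSuc_atLeastAtMost[symmetric] sum.shift_bounds_Suc_ivl) simp
    moreover have "duration ?Q = 2 * x n + (\<Sum>j\<in>{Suc i..<n}. 2 * x j)
        + (d i (i + 1) + d (i + 1) i + (\<Sum>j\<in>{Suc i..<n}. d j (j + 1) + d (j + 1) j))"
      by (simp add: duration_concat_map_upt sum.distrib flip: sum_distrib_left)
    ultimately have "duration ?Q = (\<Sum>j\<in>{Suc i..n}. 2 * x j) + (\<Sum>j\<in>{Suc i..n}. d (j - 1) j + d j (j - 1))"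
      by simp
    then have Q: "duration ?Q = (\<Sum>j\<in>{i+1..n}. 2 * x j + d (j - 1) j + d j (j - 1))"
      by (simp only: sum.distrib add.assoc Suc_eq_plus1)
    have "sweep_cycle n d x = ?P @ [(Search i, x i)] @ ?Q @ [(Search i, x i)] @ ?R"
      unfolding sweep_cycle_def split by simp
    moreover have "Search i \<notin> fst ` set (?P @ ?Q @ ?R)"
      using \<open>i < n\<close> by auto
    ultimately show thesis
      using PR Q by (rule that)
  qed
qed

section \<open>Expected detection time\<close>

theorem mainTheorem4:
  fixes n i :: nat
    and d :: "nat \<Rightarrow> nat \<Rightarrow> real"
    and rate x :: "nat \<Rightarrow> real"
  assumes "n \<ge> 2"
    and "\<And>j k. j \<in> {1..n} \<Longrightarrow> k \<in> {1..n} \<Longrightarrow> j \<noteq> k \<Longrightarrow> d j k > 0"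
    and "\<And>j. j \<in> {1..n} \<Longrightarrow> rate j > 0"
    and "\<And>j. j \<in> {1..n} \<Longrightarrow> x j > 0"
    and "i \<in> {1..n}"
  shows "let y1 = (\<Sum>j\<in>{1..<i}. 2 * x j + d j (j + 1) + d (j + 1) j);
             y2 = (\<Sum>j\<in>{i+1..n}. 2 * x j + d (j - 1) j + d j (j - 1));
             c = (\<Sum>j\<in>{1..n}. 2 * x j) + (\<Sum>j\<in>{1..<n}. d j (j + 1) + d (j + 1) j)
         in expected_detection_time (sweep_cycle n d x) rate i =
              1 / rate i
              + 1 / c * ((y1 + y2) / rate i
                  + (y1\<^sup>2 + y2\<^sup>2 + 2 * y1 * y2 * exp (- rate i * x i)) / (1 - exp (- 2 * rate i * x i))
                  - (y1\<^sup>2 + y2\<^sup>2) / 2)"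
proof -
  let ?ls = "sweep_cycle n d x" and ?r = "rate i" and ?w = "x i"
  define y1 where "y1 = (\<Sum>j\<in>{1..<i}. 2 * x j + d j (j + 1) + d (j + 1) j)"
  define y2 where "y2 = (\<Sum>j\<in>{i+1..n}. 2 * x j + d (j - 1) j + d j (j - 1))"
  define c where "c = (\<Sum>j\<in>{1..n}. 2 * x j) + (\<Sum>j\<in>{1..<n}. d j (j + 1) + d (j + 1) j)"
  define E where "E = {s. patrol_at ?ls s = Some (Search i)}"
  have r: "?r > 0" and w: "?w > 0"
    using assms by auto
  have nonneg: "\<forall>l\<in>set ?ls. snd l \<ge> 0"
    using assms(1,2,4) by (auto simp: sweep_cycle_def intro!: less_imp_le)
  obtain P Q R where dec: "?ls = P @ [(Search i, ?w)] @ Q @ [(Search i, ?w)] @ R"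
    and absent: "Search i \<notin> fst ` set (P @ Q @ R)"
    and PR: "duration P + duration R = y1" and Q: "duration Q = y2"
    unfolding y1_def y2_def using sweep_cycle_decomposition[OF assms(5)] .
  have legs_nonneg: "\<forall>l\<in>set P. snd l \<ge> 0" "\<forall>l\<in>set Q. snd l \<ge> 0" "\<forall>l\<in>set R. snd l \<ge> 0"
    using nonneg unfolding dec by auto
  then have pos: "duration P \<ge> 0" "duration R \<ge> 0" "y2 \<ge> 0"
    using duration_nonneg Q by auto
  have dur: "duration ?ls = c"
    using assms(1) unfolding c_def by (intro duration_sweep_cycle) simp
  moreover have "duration ?ls = duration P + ?w + y2 + ?w + duration R"
    unfolding dec using Q by simp
  ultimately have c: "c = duration P + ?w + y2 + ?w + duration R"
    by simp
  then have "c > 0"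
    using pos w by linarith
  define phases where "phases =
    {duration P..<duration P + ?w} \<union> {duration P + ?w + y2..<duration P + ?w + y2 + ?w}"
  have E_eq: "E = {s. s rmod c \<in> phases}"
  proof (intro set_eqI)
    fix s
    have "s rmod c \<ge> 0"
      using rmod_nonneg[of c s] \<open>c > 0\<close> by simp
    from activity_at_two_occurrences[OF dec nonneg absent this]
    show "s \<in> E \<longleftrightarrow> s \<in> {s. s rmod c \<in> phases}"
      unfolding E_def patrol_at_def dur Q phases_def mem_Collect_eq .
  qed
  interpret periodic_search E c
    unfolding E_eq by (rule periodic_search_rmod[OF \<open>c > 0\<close>]) (simp add: phases_def)
  have phase: "s \<in> E \<longleftrightarrow> s \<in> phases" if "0 \<le> s" "s < c" for s
    using that rmod_idem[of s c] by (simp add: E_eq)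
  have "{s \<in> {t..t'}. patrol_at ?ls s = Some (Search i)} = {t..t'} \<inter> E" for t t'
    by (auto simp: E_def)
  then have "search_time ?ls i t t' = searched t t'" for t t'
    by (simp add: search_time_def searched_def)
  then have "expected_detection_time ?ls rate i = 1 / c * (LINT t:{0..c}|lborel. mean_delay ?r t)"
    by (simp add: expected_detection_time_def mean_delay_def dur)
  also have "(LINT t:{0..c}|lborel. mean_delay ?r t) = c / ?r + ((y1 + y2) / ?r
      + (y1\<^sup>2 + y2\<^sup>2 + 2 * y1 * y2 * exp (- ?r * ?w)) / (1 - exp (- 2 * ?r * ?w)) - (y1\<^sup>2 + y2\<^sup>2) / 2)"
    using integral_mean_delay_two_searches[OF r pos(1) w pos(3,2) c phase[unfolded phases_def]]
    by (simp add: PR)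
  also have "1 / c * (c / ?r + K) = 1 / ?r + 1 / c * K" for K
    using \<open>c > 0\<close> by (simp add: distrib_left)
  finally show ?thesis
    unfolding Let_def y1_def y2_def c_def .
qed

end
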